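(* (Existence and uniqueness.) Let $G=(V,E,\omega)\in\mathbb{G}_\pi$ and let $\mathcal{V}$ be any nonempty subset of $V$. Then there exist $m\ge1$ and sets $S_1,\dots,S_{m-1}$ such that $S_1,\dots,S_{m-1},\mathcal{V}$ induces a sequence of reductions on $G$. Moreover, for any sequence $T_1,\dots,T_{n-1},\mathcal{V}$ inducing a sequence of reductions on $G$, the graph $\mathcal{R}(G;T_1,\dots,T_{n-1},\mathcal{V})$ is the same graph (denoted $\mathcal{R}_{\mathcal{V}}[G]$), independent of the particular sets $T_1,\dots,T_{n-1}$.
   Context: $\mathbb{W}$ is the field of complex rational functions $p/q$ in $\lambda$ ($p,q\in\mathbb{C}[\lambda]$, $q\ne0$, lowest terms). $\mathbb{G}$ is the class of finite weighted digraphs $G=(V,E,\omega)$, no parallel edges, loops allowed, $\omega:E\to\mathbb{W}$, $\omega(e)=0$ iff $e\notin E$; $M(G)_{ij}=\omega(v_i,v_j)$. For $w=p/q\in\mathbb{W}$, $\pi(w)=\deg p-\deg q$ (with $\deg 0=-\infty$); $\mathbb{G}_\pi$ is the set of $G\in\mathbb{G}$ with $\pi(M(G)_{ij})\le0$ for all $i,j$. Paths/cycles: sequences of distinct vertices joined by consecutive edges (cycles: first vertex = last; loops are cycles); interior vertices are all but first and last. A structural set of $G$ is a nonempty $S\subseteq V$ such that $V\setminus S$ induces no cycles in $G$ with loops removed and $\omega(v_i,v_i)\ne\lambda$ for all $v_i\notin S$; $st(G)$ is their set. $\mathcal{B}_{ij}(G;S)$: paths or cycles from $v_i\in S$ to $v_j\in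 S$ with no interior vertex in $S$. Branch product of $\beta=u_1,\dots,u_k$: $\omega(u_1,u_2)\prod_{t=2}^{k-1}\omega(u_t,u_{t+1})/(\lambda-\omega(u_t,u_t))$ ($=\omega(u_1,u_2)$ if $k=2$). $\mathcal{R}_S(G)$: weighted digraph on vertex set $S$ with edge $(v_i,v_j)$ iff $\mathcal{B}_{ij}(G;S)\ne\emptyset$, weighted by the sum of the branch products over $\mathcal{B}_{ij}(G;S)$. $S_1,\dots,S_m\subseteq V$ induce a sequence of reductions on $G$ if $S_1\in st(G)$ and, with $\mathcal{R}_1(G)=\mathcal{R}_{S_1}(G)$, for $1\le i\le m-1$: $S_{i+1}\in st(\mathcal{R}_i(G))$ and $\mathcal{R}_{i+1}(G)=\mathcal{R}_{S_{i+1}}(\mathcal{R}_i(G))$; then $\mathcal{R}(G;S_1,\dots,S_i)=\mathcal{R}_i(G)$. *)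

theory Defs
  imports
    "Graph_Theory.Graph_Theory"
    "HOL-Computational_Algebra.Computational_Algebra"
    "HOL-Computational_Algebra.Field_as_Ring"
    "HOL-Library.Extended_Real"
begin

type_synonym ratfun = "complex poly fract"

text \<open>The indeterminate, written $\lambda$ in the literature on isospectral reductions.\<close>

definition ratX :: ratfun where
  "ratX = to_fract [:0, 1:]"

text \<open>The function $\pi$; \<open>quot_of_fract\<close> returns numerator and denominator in lowest terms.\<close>

definition ratdeg :: "ratfun \<Rightarrow> ereal" where
  "ratdeg w = (if w = 0 then - \<infinity>
     else (case quot_of_fract w of (p, q) \<Rightarrow> ereal (real (degree p) - real (degree q))))"

text \<open>The weight function is total; it is only meaningful on the arcs and is kept \<open>0\<close>
  elsewhere, so that equality of records is equality of weighted digraphs.\<close>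

record 'v wdigraph =
  dgr :: "'v pair_pre_digraph"
  wt :: "'v \<times> 'v \<Rightarrow> ratfun"

abbreviation wverts :: "'v wdigraph \<Rightarrow> 'v set" where
  "wverts G \<equiv> pverts (dgr G)"

abbreviation warcs :: "'v wdigraph \<Rightarrow> 'v rel" where
  "warcs G \<equiv> parcs (dgr G)"

definition wdigraphs :: "'v wdigraph set" where
  "wdigraphs = {G. pair_fin_digraph (dgr G) \<and> (\<forall>e. wt G e = 0 \<longleftrightarrow> e \<notin> warcs G)}"

definition wdigraphs_pi :: "'v wdigraph set" where
  "wdigraphs_pi = {G \<in> wdigraphs. \<forall>u\<in>wverts G. \<forall>v\<in>wverts G. ratdeg (wt G (u, v)) \<le> 0}"

text \<open>Cycles as vertex sequences whose first and last vertex agree; loops \<open>[v, v]\<close> are included.\<close>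

definition vcycle :: "'v vwalk \<Rightarrow> ('v, 'b) pre_digraph \<Rightarrow> bool" where
  "vcycle p G \<longleftrightarrow> vwalk p G \<and> 2 \<le> length p \<and> hd p = last p \<and> distinct (tl p)"

definition del_loops :: "'v pair_pre_digraph \<Rightarrow> 'v pair_pre_digraph" where
  "del_loops G = \<lparr> pverts = pverts G, parcs = parcs G - Id \<rparr>"

definition st :: "'v wdigraph \<Rightarrow> 'v set set" where
  "st G = {S. S \<noteq> {} \<and> S \<subseteq> wverts G
     \<and> \<not> (\<exists>p. vcycle p (with_proj (del_loops (dgr G)) \<restriction> (wverts G - S)))
     \<and> (\<forall>v \<in> wverts G - S. wt G (v, v) \<noteq> ratX)}"

definition interior_verts :: "'v vwalk \<Rightarrow> 'v set" where
  "interior_verts p = set (butlast (tl p))"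

text \<open>The condition on the length excludes the trivial path \<open>[v]\<close>, which has no arc
  and hence no branch product.\<close>

definition branches :: "'v wdigraph \<Rightarrow> 'v set \<Rightarrow> 'v \<Rightarrow> 'v \<Rightarrow> 'v vwalk set" where
  "branches G S u v = {p. u \<in> S \<and> v \<in> S
     \<and> (vpath p (with_proj (dgr G)) \<or> vcycle p (with_proj (dgr G)))
     \<and> 2 \<le> length p \<and> hd p = u \<and> last p = v \<and> interior_verts p \<inter> S = {}}"

definition branch_prod :: "'v wdigraph \<Rightarrow> 'v vwalk \<Rightarrow> ratfun" where
  "branch_prod G p = wt G (p ! 0, p ! 1) *
     (\<Prod>t = 1..<length p - 1. wt G (p ! t, p ! Suc t) / (ratX - wt G (p ! t, p ! t)))"

text \<open>An arc of the reduced digraph is present as soon as there is a branch, even if the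
  branch products should cancel.\<close>

definition reduct :: "'v set \<Rightarrow> 'v wdigraph \<Rightarrow> 'v wdigraph" where
  "reduct S G = \<lparr> dgr = \<lparr> pverts = S, parcs = {(u, v). u \<in> S \<and> v \<in> S \<and> branches G S u v \<noteq> {}} \<rparr>,
                 wt = (\<lambda>(u, v). \<Sum>p\<in>branches G S u v. branch_prod G p) \<rparr>"

fun induces_reductions :: "'v wdigraph \<Rightarrow> 'v set list \<Rightarrow> bool" where
  "induces_reductions G [] \<longleftrightarrow> True"
| "induces_reductions G (S # Ss) \<longleftrightarrow> S \<in> st G \<and> induces_reductions (reduct S G) Ss"

fun reducts :: "'v wdigraph \<Rightarrow> 'v set list \<Rightarrow> 'v wdigraph" where
  "reducts G [] = G"
| "reducts G (S # Ss) = reducts (reduct S G) Ss"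

end

theory Submission
  imports Defs
begin

text \<open>
  Let \<open>M\<close> be the weight matrix of \<open>G\<close> and \<open>R\<close> that of a reduction to \<open>S\<close>. A vector on \<open>S\<close>
  extends uniquely to a vector \<open>x\<close> on \<open>V\<close> with \<open>(M x)\<^sub>i = \<lambda> x\<^sub>i\<close> for all \<open>i \<notin> S\<close>, the
  coefficients of the extension being the sums of the products along the paths leading into \<open>S\<close>, and
  \<open>R (x|S) = (M x)|S\<close> for every such \<open>x\<close>. This property is transitive, and it determines \<open>R\<close>.
  The arcs of a reduction join the vertices connected by a walk with interior outside \<open>S\<close>,
  which again is transitive; hence uniqueness. For existence, delete one vertex at a time:
  the rational functions of degree at most \<open>0\<close> form a ring that contains \<open>1 / (\<lambda> - w)\<close> for
  each of its elements \<open>w\<close>, so no loop of a reduced graph ever has weight \<open>\<lambda>\<close>.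
\<close>

section \<open>Connection through the complement of a set\<close>

text \<open>Walks rather than paths, with interior outside \<open>S\<close>: walks concatenate
  freely, which makes iterated reductions comparable. The ends may lie in \<open>S\<close>.\<close>

inductive passes :: "'v rel \<Rightarrow> 'v set \<Rightarrow> 'v \<Rightarrow> 'v \<Rightarrow> bool" for A S u where
  arc: "(u, v) \<in> A \<Longrightarrow> passes A S u v"
| step: "passes A S u v \<Longrightarrow> v \<notin> S \<Longrightarrow> (v, w) \<in> A \<Longrightarrow> passes A S u w"

lemma passes_mono: "passes A S u v \<Longrightarrow> T \<subseteq> S \<Longrightarrow> passes A T u v"
  by (induction rule: passes.induct) (auto intro: passes.intros)

lemma passes_trans:
  assumes "passes A S v w" "passes A S u v" "v \<notin> S"
  shows "passes A S u w"
  using assms by (induction rule: passes.induct) (auto intro: passes.intros)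

lemma passes_Cons:
  assumes "passes A S v w" "(u, v) \<in> A" "v \<notin> S"
  shows "passes A S u w"
  using assms by (auto intro: passes_trans passes.intros)

text \<open>The walk is cut at its last interior visit \<open>w\<close> to \<open>S\<close>. The end
  \<open>v\<close> may lie outside \<open>S\<close>, since the induction runs through all prefixes
  of the walk.\<close>

lemma passes_factor:
  assumes "passes A T u v" "u \<in> S" "T \<subseteq> S"
  defines "A' \<equiv> {(u, v). u \<in> S \<and> v \<in> S \<and> passes A S u v}"
  shows "passes A S u v \<or> (\<exists>w\<in>S - T. passes A' T u w \<and> passes A S w v)"
  using assms(1)
proof induction
  case (arc v)
  then show ?case by (blast intro: passes.arc)
next
  case (step v v')
  show ?case
  proof (cases "v \<in> S")
    case False
    then show ?thesis using step by (blast intro: passes.step)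
  next
    case True
    have "passes A' T u v"
      using step.IH
    proof (elim disjE bexE conjE)
      assume "passes A S u v"
      then have "(u, v) \<in> A'" using True assms(2) by (simp add: A'_def)
      then show ?thesis by (rule passes.arc)
    next
      fix w assume w: "w \<in> S - T" "passes A' T u w" "passes A S w v"
      then have "(w, v) \<in> A'" using True by (simp add: A'_def)
      then show ?thesis using w by (blast intro: passes.step)
    qed
    moreover have "passes A S v v'" using step.hyps(3) by (rule passes.arc)
    ultimately show ?thesis using True step.hyps(2) by blast
  qed
qed

text \<open>Each arc of the inner relation expands to a walk; conversely, the last piece left by
  \<open>passes_factor\<close> is itself such an arc because \<open>v\<close> lies in
  \<open>S\<close>.\<close>

lemma passes_passes_iff:
  assumes "T \<subseteq> S" "u \<in> T" "v \<in> T"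
  shows "passes {(u, v). u \<in> S \<and> v \<in> S \<and> passes A S u v} T u v \<longleftrightarrow> passes A T u v"
    (is "passes ?A' T u v \<longleftrightarrow> _")
proof
  assume "passes ?A' T u v"
  then show "passes A T u v"
  proof induction
    case (arc v)
    then show ?case using assms(1) by (auto intro: passes_mono)
  next
    case (step v w)
    then have "passes A T v w" using assms(1) by (auto intro: passes_mono)
    then show ?case using step by (blast intro: passes_trans)
  qed
next
  assume "passes A T u v"
  then have "passes A S u v \<or> (\<exists>w\<in>S - T. passes ?A' T u w \<and> passes A S w v)"
    using assms by (intro passes_factor) auto
  then show "passes ?A' T u v"
  proof (elim disjE bexE conjE)
    assume "passes A S u v"
    then have "(u, v) \<in> ?A'" using assms by auto
    then show ?thesis by (rule passes.arc)
  next
    fix w assume w: "w \<in> S - T" "passes ?A' T u w" "passes A S w v"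
    then have "(w, v) \<in> ?A'" using assms by auto
    then show ?thesis using w by (blast intro: passes.step)
  qed
qed

lemma passes_all_iff:
  assumes "A \<subseteq> S \<times> S"
  shows "passes A S u v \<longleftrightarrow> (u, v) \<in> A"
proof
  show "passes A S u v \<Longrightarrow> (u, v) \<in> A"
    by (induction rule: passes.induct) (use assms in auto)
qed (rule passes.arc)

text \<open>When a new end repeats a vertex, the walk is cut back to the earlier occurrence. Only
  \<open>p\<close> is distinct, not \<open>u # p\<close>, so that cycles with \<open>u = v\<close>
  are covered.\<close>

lemma passes_imp_simple_walk:
  assumes "passes A S u v"
  shows "\<exists>p. p \<noteq> [] \<and> last p = v \<and> distinct p \<and> set (butlast p) \<inter> S = {}
    \<and> set (vwalk_arcs (u # p)) \<subseteq> A"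
  using assms
proof induction
  case (arc v)
  then show ?case by (intro exI[of _ "[v]"]) auto
next
  case (step v w)
  then obtain p where p: "p \<noteq> []" "last p = v" "distinct p" "set (butlast p) \<inter> S = {}"
    "set (vwalk_arcs (u # p)) \<subseteq> A" by blast
  have pS: "set p \<inter> S = {}"
    using p(1,2,4) step.hyps(2) by (cases p rule: rev_cases) auto
  show ?case
  proof (cases "w \<in> set p")
    case True
    then obtain q r where q: "p = q @ w # r" by (auto simp: in_set_conv_decomp)
    have "set (vwalk_arcs (u # q @ [w])) \<subseteq> A"
      using p(5) set_vwalk_arcs_append1[of "u # q @ [w]" r] by (auto simp: q)
    then show ?thesis
      using p pS by (intro exI[of _ "q @ [w]"]) (auto simp: q)
  next
    case False
    have "set (vwalk_arcs (u # p @ [w])) \<subseteq> A"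
      using p step.hyps(3) vwalk_arcs_append[of "u # p" "[w]"] by auto
    then show ?thesis
      using p pS False by (intro exI[of _ "p @ [w]"]) auto
  qed
qed

lemma walk_imp_passes:
  assumes "p \<noteq> []" "set (butlast p) \<inter> S = {}" "set (vwalk_arcs (u # p)) \<subseteq> A"
  shows "passes A S u (last p)"
  using assms
proof (induction p arbitrary: u)
  case (Cons a p)
  show ?case
  proof (cases "p = []")
    case True
    then show ?thesis using Cons.prems by (auto intro: passes.arc)
  next
    case False
    then have "passes A S a (last p)" using Cons by simp
    then show ?thesis using Cons.prems False passes_Cons[of A S a "last p" u] by simp
  qed
qed simp

section \<open>Reduction as elimination of variables\<close>

text \<open>Arcs of weight \<open>0\<close> are allowed here, since branch products may cancel in a reduced graph.\<close>

definition weighted :: "'v wdigraph \<Rightarrow> bool" where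
  "weighted G \<longleftrightarrow> finite (wverts G) \<and> warcs G \<subseteq> wverts G \<times> wverts G \<and> (\<forall>e. e \<notin> warcs G \<longrightarrow> wt G e = 0)"

definition wmult :: "'v wdigraph \<Rightarrow> ('v \<Rightarrow> ratfun) \<Rightarrow> 'v \<Rightarrow> ratfun" where
  "wmult G x i = (\<Sum>j\<in>wverts G. wt G (i, j) * x j)"

definition eigen_off :: "'v wdigraph \<Rightarrow> 'v set \<Rightarrow> ('v \<Rightarrow> ratfun) \<Rightarrow> bool" where
  "eigen_off G S x \<longleftrightarrow> (\<forall>i\<in>wverts G - S. wmult G x i = ratX * x i)"

text \<open>The last two conjuncts describe elimination of the variables outside
  \<open>wverts H\<close> without mention of branches. Arcs are fixed separately because cancelling
  branch products leave arcs of weight 0.\<close>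

definition reduces :: "'v wdigraph \<Rightarrow> 'v wdigraph \<Rightarrow> bool" where
  "reduces G H \<longleftrightarrow> weighted H \<and> wverts H \<subseteq> wverts G
    \<and> warcs H = {(u, v). u \<in> wverts H \<and> v \<in> wverts H \<and> passes (warcs G) (wverts H) u v}
    \<and> (\<forall>x. eigen_off G (wverts H) x \<longrightarrow> (\<forall>i\<in>wverts H. wmult H x i = wmult G x i))
    \<and> (\<forall>y. \<exists>x. (\<forall>i\<in>wverts H. x i = y i) \<and> eigen_off G (wverts H) x)"

lemma wmult_cong: "(\<And>j. j \<in> wverts G \<Longrightarrow> x j = y j) \<Longrightarrow> wmult G x i = wmult G y i"
  by (simp add: wmult_def)

lemma reduces_refl: "weighted G \<Longrightarrow> reduces G G"
  by (auto simp: reduces_def eigen_off_def weighted_def passes_all_iff)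

text \<open>Variables may be eliminated in two stages: on solutions off \<open>wverts H\<close>, the
  rows of \<open>G\<close> and \<open>H\<close> at \<open>wverts H\<close> agree. Extensions are
  built in the same two stages.\<close>

lemma reduces_trans:
  assumes GH: "reduces G H" and HK: "reduces H K"
  shows "reduces G K"
proof -
  have sub: "wverts H \<subseteq> wverts G" "wverts K \<subseteq> wverts H" "weighted K"
    using assms by (auto simp: reduces_def)
  have lin: "\<forall>i\<in>wverts H. wmult H x i = wmult G x i" if "eigen_off G (wverts H) x" for x
    using GH that by (auto simp: reduces_def)
  have linK: "\<forall>i\<in>wverts K. wmult K x i = wmult H x i" if "eigen_off H (wverts K) x" for x
    using HK that by (auto simp: reduces_def)
  have arcsH: "warcs H = {(u, v). u \<in> wverts H \<and> v \<in> wverts H \<and> passes (warcs G) (wverts H) u v}"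
    using GH by (simp add: reduces_def)
  have arcsK: "warcs K = {(u, v). u \<in> wverts K \<and> v \<in> wverts K \<and> passes (warcs H) (wverts K) u v}"
    using HK by (simp add: reduces_def)
  have "warcs K = {(u, v). u \<in> wverts K \<and> v \<in> wverts K \<and> passes (warcs G) (wverts K) u v}"
    unfolding arcsK arcsH using passes_passes_iff[OF sub(2)] by blast
  moreover have "\<forall>i\<in>wverts K. wmult K x i = wmult G x i" if x: "eigen_off G (wverts K) x" for x
  proof -
    have xH: "eigen_off G (wverts H) x" using x sub by (auto simp: eigen_off_def)
    have "eigen_off H (wverts K) x" using lin[OF xH] x sub by (auto simp: eigen_off_def)
    then show ?thesis using linK lin[OF xH] sub by auto
  qed
  moreover have "\<exists>x. (\<forall>i\<in>wverts K. x i = y i) \<and> eigen_off G (wverts K) x" for y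
  proof -
    obtain z where z: "\<forall>i\<in>wverts K. z i = y i" "eigen_off H (wverts K) z"
      using HK unfolding reduces_def by blast
    obtain x where x: "\<forall>i\<in>wverts H. x i = z i" "eigen_off G (wverts H) x"
      using GH unfolding reduces_def by blast
    \<comment> \<open>Off \<open>wverts H\<close> this is the choice of \<open>x\<close>; inside,
      row \<open>i\<close> of \<open>G\<close> acts on \<open>x\<close> as row \<open>i\<close> of
      \<open>H\<close> acts on \<open>z\<close>.\<close>
    have "wmult G x i = ratX * x i" if i: "i \<in> wverts G - wverts K" for i
    proof (cases "i \<in> wverts H")
      case True
      then have "wmult G x i = wmult H z i"
        using lin[OF x(2)] x(1) wmult_cong[of H x z] by metis
      then show ?thesis using True i z(2) x(1) by (auto simp: eigen_off_def)
    qed (use x(2) i in \<open>auto simp: eigen_off_def\<close>)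
    then show ?thesis using z(1) x(1) sub by (intro exI[of _ x]) (auto simp: eigen_off_def)
  qed
  ultimately show ?thesis using sub by (auto simp: reduces_def)
qed

text \<open>The extension of the unit vector at \<open>j\<close> is a test vector: row
  \<open>i\<close> of either reduction sends it to entry \<open>(i, j)\<close>, and both values
  equal \<open>wmult G x i\<close>.\<close>

lemma reduces_wt_eq:
  assumes "reduces G H" "reduces G K" "wverts H = wverts K" "i \<in> wverts H" "j \<in> wverts H"
  shows "wt H (i, j) = wt K (i, j)"
proof -
  define e where "e = (\<lambda>k. if k = j then 1 else 0 :: ratfun)"
  obtain x where x: "\<forall>i\<in>wverts H. x i = e i" "eigen_off G (wverts H) x"
    using assms(1) unfolding reduces_def by blast
  have "wmult F x i = wt F (i, j)" if "weighted F" "wverts F = wverts H" for F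
  proof -
    have "wmult F x i = wmult F e i" using x(1) that by (intro wmult_cong) auto
    also have "\<dots> = (\<Sum>k\<in>wverts F. if k = j then wt F (i, j) else 0)"
      unfolding wmult_def e_def by (rule sum.cong) auto
    finally show ?thesis using that assms(5) by (simp add: weighted_def)
  qed
  moreover have "wmult H x i = wmult G x i" "wmult K x i = wmult G x i"
    using assms x(2) unfolding reduces_def by auto
  ultimately show ?thesis
    using assms(1-3) unfolding reduces_def by metis
qed

lemma reduces_unique:
  assumes "reduces G H" "reduces G K" "wverts H = wverts K"
  shows "H = K"
proof -
  have arcs: "warcs H = warcs K"
    using assms by (simp add: reduces_def)
  have "wt H (i, j) = wt K (i, j)" for i j
  proof (cases "(i, j) \<in> warcs H")
    case True
    then have "i \<in> wverts H" "j \<in> wverts H" using assms(1) by (auto simp: reduces_def)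
    then show ?thesis using reduces_wt_eq assms by metis
  next
    case False
    then have "(i, j) \<notin> warcs K" using arcs by simp
    moreover have "weighted H" "weighted K" using assms(1,2) by (simp_all add: reduces_def)
    ultimately show ?thesis using False by (simp add: weighted_def)
  qed
  then have "wt H = wt K" by auto
  then show ?thesis using arcs assms(3) by (cases H; cases K) (auto intro: pair_pre_digraph.equality)
qed

section \<open>A single reduction\<close>

text \<open>The loop factor is attached to the tail of each arc, so the last vertex contributes
  none.\<close>

definition path_prod :: "'v wdigraph \<Rightarrow> 'v vwalk \<Rightarrow> ratfun" where
  "path_prod G p = (\<Prod>(u, v)\<leftarrow>vwalk_arcs p. wt G (u, v) / (ratX - wt G (u, u)))"

lemma path_prod_Cons:
  "q \<noteq> [] \<Longrightarrow> path_prod G (u # q) = wt G (u, hd q) / (ratX - wt G (u, u)) * path_prod G q"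
  by (simp add: path_prod_def)

lemma path_prod_singleton [simp]: "path_prod G [v] = 1"
  by (simp add: path_prod_def)

lemma path_prod_conv_prod:
  "path_prod G q = (\<Prod>t<length q - 1. wt G (q ! t, q ! Suc t) / (ratX - wt G (q ! t, q ! t)))"
proof (induction q)
  case (Cons u q)
  show ?case
  proof (cases q)
    case (Cons v r)
    then show ?thesis
      using Cons.IH by (simp add: path_prod_Cons prod.lessThan_Suc_shift del: prod.lessThan_Suc)
  qed simp
qed (simp add: path_prod_def)

text \<open>The interior vertices of \<open>u # q\<close> are the tails of the arcs of
  \<open>q\<close>, so the loop factors agree; indices shift by one.\<close>

lemma branch_prod_Cons:
  assumes "q \<noteq> []"
  shows "branch_prod G (u # q) = wt G (u, hd q) * path_prod G q"
proof -
  have "(\<Prod>t = 1..<length (u # q) - 1. f t) = (\<Prod>t<length q - 1. f (Suc t))" for f :: "nat \<Rightarrow> ratfun"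
    using assms prod.shift_bounds_Suc_ivl[of f 0 "length q - 1"] by (simp add: atLeast0LessThan)
  then show ?thesis
    using assms unfolding branch_prod_def path_prod_conv_prod by (simp add: hd_conv_nth)
qed

section \<open>Paths that stop on reaching a set\<close>

definition exit_paths :: "'v wdigraph \<Rightarrow> 'v set \<Rightarrow> 'v \<Rightarrow> 'v \<Rightarrow> 'v vwalk set" where
  "exit_paths G S k j = {p. vpath p (with_proj (dgr G)) \<and> hd p = k \<and> last p = j \<and> set (butlast p) \<inter> S = {}}"

text \<open>For \<open>j \<in> S\<close>, the coefficient of \<open>x j\<close> in the value at
  \<open>k\<close> of the extension of a vector on \<open>S\<close>.\<close>

definition exit_weight :: "'v wdigraph \<Rightarrow> 'v set \<Rightarrow> 'v \<Rightarrow> 'v \<Rightarrow> ratfun" where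
  "exit_weight G S k j = (\<Sum>p\<in>exit_paths G S k j. path_prod G p)"

lemma finite_vpaths:
  assumes "finite (wverts G)"
  shows "finite {p. vpath p (with_proj (dgr G))}"
  by (rule finite_subset[OF _ finite_subset_distinct[OF assms]])
    (auto simp: vpath_def vwalk_def)

lemma finite_exit_paths: "finite (wverts G) \<Longrightarrow> finite (exit_paths G S k j)"
  by (rule finite_subset[OF _ finite_vpaths]) (auto simp: exit_paths_def)

lemma exit_paths_from_S:
  assumes "k \<in> S" "k \<in> wverts G"
  shows "exit_paths G S k j = (if k = j then {[k]} else {})"
proof -
  have "p = [k]" if "p \<in> exit_paths G S k j" for p
    using that assms by (cases p) (auto simp: exit_paths_def vpath_def split: if_splits)
  then have "exit_paths G S k j \<subseteq> {[k]}" by blast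
  moreover have "[k] \<in> exit_paths G S k j \<longleftrightarrow> k = j"
    using assms by (auto simp: exit_paths_def vpath_def vwalk_def)
  ultimately show ?thesis by auto
qed

lemma exit_weight_from_S:
  "k \<in> S \<Longrightarrow> k \<in> wverts G \<Longrightarrow> exit_weight G S k j = (if k = j then 1 else 0)"
  by (simp add: exit_weight_def exit_paths_from_S)

text \<open>Removing the first vertex turns paths and cycles alike into exit paths, since a cycle is
  distinct apart from its first vertex.\<close>

lemma branches_eq:
  assumes "weighted G" "S \<subseteq> wverts G" "i \<in> S" "j \<in> S"
  shows "branches G S i j = (\<Union>k\<in>{k. (i, k) \<in> warcs G}. (#) i ` exit_paths G S k j)"
proof (intro set_eqI iffI)
  fix p assume p: "p \<in> branches G S i j"
  then have "2 \<le> length p" "hd p = i" by (auto simp: branches_def)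
  then obtain q where q: "p = i # q" "q \<noteq> []"
    by (cases p; cases "tl p") auto
  have "distinct q" "vwalk (i # q) (with_proj (dgr G))"
    using p by (auto simp: branches_def vpath_def vcycle_def q)
  then show "p \<in> (\<Union>k\<in>{k. (i, k) \<in> warcs G}. (#) i ` exit_paths G S k j)"
    using p by (auto simp: branches_def exit_paths_def interior_verts_def vpath_def q elim!: vwalk_consE)
next
  fix p assume "p \<in> (\<Union>k\<in>{k. (i, k) \<in> warcs G}. (#) i ` exit_paths G S k j)"
  then obtain q where q: "(i, hd q) \<in> warcs G" "q \<in> exit_paths G S (hd q) j" "p = i # q"
    by (auto simp: exit_paths_def)
  have ne: "q \<noteq> []" "distinct q" "last q = j" "set (butlast q) \<inter> S = {}"
    and w: "vwalk q (with_proj (dgr G))"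
    using q(2) by (auto simp: exit_paths_def vpath_def vwalk_def)
  have wi: "vwalk (i # q) (with_proj (dgr G))"
    using q(1) w assms by (intro vwalk_consI) auto
  \<comment> \<open>As \<open>i \<in> S\<close>, it can recur in \<open>q\<close> only at the end;
    this decides between path and cycle.\<close>
  have "i \<notin> set (butlast q)" using ne(4) assms(3) by auto
  then have "i \<noteq> j \<Longrightarrow> i \<notin> set q" using ne(1,3) by (cases q rule: rev_cases) auto
  then show "p \<in> branches G S i j"
    using wi ne assms q(3)
    by (cases "i = j") (auto simp: branches_def vpath_def vcycle_def interior_verts_def Suc_le_eq)
qed

text \<open>Shortening a walk to a simple one keeps its interior off \<open>S\<close>, so walks and
  branches join the same pairs.\<close>

lemma branches_nonempty_iff:
  assumes "weighted G" "S \<subseteq> wverts G" "u \<in> S" "v \<in> S"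
  shows "branches G S u v \<noteq> {} \<longleftrightarrow> passes (warcs G) S u v"
proof
  assume "branches G S u v \<noteq> {}"
  then obtain k q where "(u, k) \<in> warcs G" "q \<in> exit_paths G S k v"
    unfolding branches_eq[OF assms] by blast
  then show "passes (warcs G) S u v"
    using walk_imp_passes[of q S u "warcs G"]
    by (auto simp: exit_paths_def vpath_def vwalk_def)
next
  assume "passes (warcs G) S u v"
  then obtain p where p: "p \<noteq> []" "last p = v" "distinct p" "set (butlast p) \<inter> S = {}"
    "set (vwalk_arcs (u # p)) \<subseteq> warcs G" using passes_imp_simple_walk by meson
  have "set p \<subseteq> wverts G"
    using p(1,5)
  proof (induction p arbitrary: u)
    case (Cons a p)
    then show ?case using assms(1) by (cases "p = []") (auto simp: weighted_def)
  qed simp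
  then have "p \<in> exit_paths G S (hd p) v" "(u, hd p) \<in> warcs G"
    using p by (auto simp: exit_paths_def vpath_def vwalk_def)
  then show "branches G S u v \<noteq> {}"
    unfolding branches_eq[OF assms] by blast
qed

lemma weighted_reduct:
  assumes "weighted G" "S \<subseteq> wverts G"
  shows "weighted (reduct S G)"
proof -
  have "branches G S u v = {}" if "u \<notin> S \<or> v \<notin> S" for u v
    using that by (auto simp: branches_def)
  then show ?thesis
    using assms by (auto simp: weighted_def reduct_def intro: finite_subset)
qed

text \<open>General \<open>f\<close> and \<open>c\<close> serve both branch products and path
  products. The pieces are disjoint since \<open>q\<close> determines its head
  \<open>k\<close>.\<close>

lemma sum_Cons_exit_paths:
  assumes "finite (wverts G)" "finite L"
    and "\<And>q. q \<noteq> [] \<Longrightarrow> f (i # q) = c (hd q) * path_prod G q"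
  shows "sum f (\<Union>k\<in>L. (#) i ` exit_paths G S k j) = (\<Sum>k\<in>L. c k * exit_weight G S k j)"
proof -
  have disj: "(#) i ` exit_paths G S k j \<inter> (#) i ` exit_paths G S l j = {}" if "k \<noteq> l" for k l
    using that by (auto simp: exit_paths_def)
  have "sum f (\<Union>k\<in>L. (#) i ` exit_paths G S k j) = (\<Sum>k\<in>L. sum f ((#) i ` exit_paths G S k j))"
    using assms disj by (intro sum.UNION_disjoint) (auto simp: finite_exit_paths)
  also have "\<dots> = (\<Sum>k\<in>L. c k * exit_weight G S k j)"
  proof (rule sum.cong)
    fix k
    have "sum f ((#) i ` exit_paths G S k j) = (\<Sum>q\<in>exit_paths G S k j. f (i # q))"
      by (simp add: sum.reindex)
    also have "\<dots> = (\<Sum>q\<in>exit_paths G S k j. c k * path_prod G q)"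
      by (intro sum.cong) (auto simp: assms(3) exit_paths_def vpath_def vwalk_def)
    finally show "sum f ((#) i ` exit_paths G S k j) = c k * exit_weight G S k j"
      by (simp add: exit_weight_def sum_distrib_left)
  qed simp
  finally show ?thesis .
qed

text \<open>The first arc of each branch is split off; non-arcs have weight 0, so the sum may run
  over all vertices as in a matrix product.\<close>

lemma wt_reduct:
  assumes "weighted G" "S \<subseteq> wverts G" "i \<in> S" "j \<in> S"
  shows "wt (reduct S G) (i, j) = (\<Sum>k\<in>wverts G. wt G (i, k) * exit_weight G S k j)"
proof -
  have fin: "finite (wverts G)" "{k. (i, k) \<in> warcs G} \<subseteq> wverts G"
    using assms(1) by (auto simp: weighted_def)
  have "wt (reduct S G) (i, j) = (\<Sum>k | (i, k) \<in> warcs G. wt G (i, k) * exit_weight G S k j)"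
    using assms fin
    by (simp add: reduct_def branches_eq sum_Cons_exit_paths[where c = "\<lambda>k. wt G (i, k)"]
        branch_prod_Cons finite_subset)
  also have "\<dots> = (\<Sum>k\<in>wverts G. wt G (i, k) * exit_weight G S k j)"
    using fin assms(1) by (intro sum.mono_neutral_left) (auto simp: weighted_def)
  finally show ?thesis .
qed

section \<open>Absence of cycles and the recursion for exit weights\<close>

lemma vwalk_arcs_distinct: "distinct p \<Longrightarrow> (u, v) \<in> set (vwalk_arcs p) \<Longrightarrow> u \<noteq> v"
  by (induction p rule: vwalk_arcs.induct) auto

lemma vwalk_arcs_subset: "set (vwalk_arcs p) \<subseteq> set p \<times> set p"
  by (induction p rule: vwalk_arcs.induct) auto

text \<open>A return to \<open>k\<close> would close a cycle outside \<open>S\<close> that contains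
  no loop and hence survives \<open>del_loops\<close>.\<close>

lemma st_no_return:
  assumes "S \<in> st G" "(k, hd p) \<in> warcs G" "hd p \<noteq> k" "k \<notin> S"
    and "vpath p (with_proj (dgr G))" "set (butlast p) \<inter> S = {}"
  shows "k \<notin> set p"
proof
  assume "k \<in> set p"
  then obtain q r where p: "p = q @ k # r" by (auto simp: in_set_conv_decomp)
  have pw: "distinct p" "set p \<subseteq> wverts G" "set (vwalk_arcs p) \<subseteq> warcs G"
    using assms(5) by (auto simp: vpath_def vwalk_def)
  have q: "q \<noteq> []" using assms(3) p by auto
  let ?c = "k # q @ [k]"
  let ?U = "wverts G - S"
  have "set (vwalk_arcs (q @ [k])) \<subseteq> set (vwalk_arcs p)"
    using set_vwalk_arcs_append1[of "q @ [k]" r] by (simp add: p)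
  then have arcs: "set (vwalk_arcs ?c) \<subseteq> warcs G"
    using assms(2) pw(3) q by (auto simp: p)
  \<comment> \<open>\<open>q\<close> lies in \<open>butlast p\<close> even when \<open>k\<close> is
    the last vertex of \<open>p\<close>.\<close>
  have "set q \<inter> S = {}" using assms(6) p by (auto simp: butlast_append)
  then have U: "set ?c \<subseteq> ?U"
    using pw(2) assms(4) by (auto simp: p)
  \<comment> \<open>Distinctness of \<open>q @ [k]\<close> handles all arcs but the first, which is
    no loop since \<open>hd p \<noteq> k\<close>.\<close>
  have "u \<noteq> v" if "(u, v) \<in> set (vwalk_arcs ?c)" for u v
    using vwalk_arcs_distinct[of "q @ [k]" u v] that pw(1) q assms(3) by (auto simp: p)
  then have "set (vwalk_arcs ?c) \<subseteq> warcs G \<inter> (?U \<times> ?U) - Id"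
    using arcs U vwalk_arcs_subset[of ?c] by fast
  also have "\<dots> = arcs_ends (with_proj (del_loops (dgr G)) \<restriction> ?U)"
    by (auto simp: arcs_ends_conv del_loops_def)
  finally have "vcycle ?c (with_proj (del_loops (dgr G)) \<restriction> ?U)"
    using U pw(1) by (auto simp: vcycle_def vwalk_def p)
  then show False using assms(1) by (auto simp: st_def)
qed

text \<open>Prepending \<open>k\<close> keeps the vertices distinct by \<open>st_no_return\<close>.
  The loop at \<open>k\<close> is left out; its weight enters through the denominators of
  \<open>path_prod\<close>.\<close>

lemma exit_paths_step:
  assumes "S \<in> st G" "k \<in> wverts G - S" "j \<in> S"
  shows "exit_paths G S k j = (\<Union>l\<in>{l. (k, l) \<in> warcs G \<and> l \<noteq> k}. (#) k ` exit_paths G S l j)"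
proof (intro set_eqI iffI)
  fix p assume p: "p \<in> exit_paths G S k j"
  have "last p \<noteq> k" "p \<noteq> []" "hd p = k"
    using p assms by (auto simp: exit_paths_def vpath_def vwalk_def)
  then obtain q where q: "p = k # q" "q \<noteq> []" by (cases p) (auto split: if_splits)
  have w: "vwalk (k # q) (with_proj (dgr G))"
    using p by (simp add: exit_paths_def vpath_def q)
  have hd: "(k, hd q) \<in> warcs G"
    using w q(2) by (auto elim: vwalk_consE)
  moreover have "vwalk q (with_proj (dgr G))"
    using w q(2) by (rule vwalk_consE)
  moreover have "k \<notin> set q" using p by (simp add: exit_paths_def vpath_def q)
  then have "hd q \<noteq> k" using q(2) hd_in_set by metis
  ultimately show "p \<in> (\<Union>l\<in>{l. (k, l) \<in> warcs G \<and> l \<noteq> k}. (#) k ` exit_paths G S l j)"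
    using p q by (auto simp: exit_paths_def vpath_def)
next
  fix p assume "p \<in> (\<Union>l\<in>{l. (k, l) \<in> warcs G \<and> l \<noteq> k}. (#) k ` exit_paths G S l j)"
  then obtain q where q: "p = k # q" "(k, hd q) \<in> warcs G" "hd q \<noteq> k"
    "vpath q (with_proj (dgr G))" "last q = j" "set (butlast q) \<inter> S = {}"
    by (auto simp: exit_paths_def)
  have "k \<notin> set q" using st_no_return[OF assms(1) q(2,3) _ q(4,6)] assms(2) by blast
  moreover have "vwalk (k # q) (with_proj (dgr G))"
    using q(2,4) assms(2) by (intro vwalk_consI) (auto simp: vpath_def)
  moreover have "q \<noteq> []" using q(4) by (auto simp: vpath_def vwalk_def)
  ultimately show "p \<in> exit_paths G S k j"
    using q assms(2) by (auto simp: exit_paths_def vpath_def)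
qed

text \<open>For fixed \<open>j\<close> this is the equation of \<open>eigen_equation_iff\<close>, so
  the exit weights form an extension of the unit vector at \<open>j\<close>.\<close>

lemma exit_weight_step:
  assumes "weighted G" "S \<in> st G" "k \<in> wverts G - S" "j \<in> S"
  shows "exit_weight G S k j
    = (\<Sum>l\<in>wverts G - {k}. wt G (k, l) / (ratX - wt G (k, k)) * exit_weight G S l j)"
proof -
  let ?L = "{l. (k, l) \<in> warcs G \<and> l \<noteq> k}"
  have fin: "finite (wverts G)" "?L \<subseteq> wverts G - {k}"
    using assms(1) by (auto simp: weighted_def)
  have finL: "finite ?L" using fin by (auto intro: finite_subset)
  have "exit_weight G S k j = (\<Sum>l\<in>?L. wt G (k, l) / (ratX - wt G (k, k)) * exit_weight G S l j)"
    unfolding exit_weight_def[of G S k] exit_paths_step[OF assms(2-4)]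
    by (intro sum_Cons_exit_paths fin finL path_prod_Cons)
  also have "\<dots> = (\<Sum>l\<in>wverts G - {k}. wt G (k, l) / (ratX - wt G (k, k)) * exit_weight G S l j)"
    using fin assms(1) by (intro sum.mono_neutral_left) (auto simp: weighted_def)
  finally show ?thesis .
qed

text \<open>The loop term changes sides; the division by \<open>ratX - wt G (k, k)\<close> is
  allowed because \<open>S\<close> is structural.\<close>

lemma eigen_equation_iff:
  assumes "weighted G" "S \<in> st G" "k \<in> wverts G - S"
  shows "wmult G x k = ratX * x k
    \<longleftrightarrow> x k = (\<Sum>l\<in>wverts G - {k}. wt G (k, l) / (ratX - wt G (k, k)) * x l)"
proof -
  let ?s = "\<Sum>l\<in>wverts G - {k}. wt G (k, l) * x l"
  have "wt G (k, k) \<noteq> ratX" using assms(2,3) by (simp add: st_def)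
  then have "x k = ?s / (ratX - wt G (k, k)) \<longleftrightarrow> x k * (ratX - wt G (k, k)) = ?s"
    by (simp add: eq_divide_eq)
  moreover have "wmult G x k = wt G (k, k) * x k + ?s"
    unfolding wmult_def using assms(1,3) by (intro sum.remove) (auto simp: weighted_def)
  moreover have "(\<Sum>l\<in>wverts G - {k}. wt G (k, l) / (ratX - wt G (k, k)) * x l)
      = ?s / (ratX - wt G (k, k))"
    by (simp add: sum_divide_distrib)
  ultimately show ?thesis by (simp only:) (auto simp: algebra_simps)
qed

text \<open>The equation at \<open>k\<close> expresses \<open>x k\<close> through out-neighbours
  other than \<open>k\<close>; repeated substitution terminates because off \<open>S\<close> all
  cycles are loops.\<close>

lemma eigen_off_extension:
  assumes "weighted G" "S \<in> st G" "eigen_off G S x" "k \<in> wverts G"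
  shows "x k = (\<Sum>j\<in>S. exit_weight G S k j * x j)"
proof -
  have finS: "finite S" using assms(1,2) by (auto simp: weighted_def st_def intro: finite_subset)
  \<comment> \<open>The number of paths off \<open>S\<close> that start at \<open>k\<close> is the
    termination measure; it is 0 for \<open>k \<in> S\<close>.\<close>
  define paths where
    "paths k = {p. vpath p (with_proj (dgr G)) \<and> hd p = k \<and> set p \<inter> S = {}}" for k
  have fin_paths: "finite (paths k)" for k
    using assms(1) finite_vpaths[of G] unfolding paths_def weighted_def
    by (auto elim: rev_finite_subset)
  have decreasing: "card (paths l) < card (paths k)"
    if kl: "(k, l) \<in> warcs G" "l \<noteq> k" "k \<in> wverts G - S" for k l
  proof -
    have "k # q \<in> paths k" if q: "q \<in> paths l" for q
    proof -
      have "set (butlast q) \<inter> S = {}" using q by (auto simp: paths_def dest: in_set_butlastD)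
      then have "k \<notin> set q"
        using st_no_return[OF assms(2), of k q] kl q
        by (auto simp: paths_def)
      moreover have "vwalk (k # q) (with_proj (dgr G))"
        using q kl
        by (intro vwalk_consI) (auto simp: paths_def vpath_def)
      ultimately show ?thesis
        using q kl(3) by (auto simp: paths_def vpath_def)
    qed
    \<comment> \<open>The trivial path makes the inclusion strict, as no path is empty.\<close>
    moreover have "[k] \<in> paths k" "[k] \<notin> (#) k ` paths l"
      using kl(3) by (auto simp: paths_def vpath_def vwalk_def)
    ultimately have "(#) k ` paths l \<subset> paths k" by blast
    then have "card ((#) k ` paths l) < card (paths k)"
      using fin_paths by (intro psubset_card_mono)
    then show ?thesis by (simp add: card_image)
  qed
  show ?thesis
    using assms(4)
  proof (induction "card (paths k)" arbitrary: k rule: less_induct)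
    case less
    show ?case
    proof (cases "k \<in> S")
      case True
      then have "(\<Sum>j\<in>S. exit_weight G S k j * x j) = (\<Sum>j\<in>S. if k = j then x j else 0)"
        using less.prems by (intro sum.cong) (auto simp: exit_weight_from_S)
      then show ?thesis using True finS by simp
    next
      case False
      let ?c = "\<lambda>l. wt G (k, l) / (ratX - wt G (k, k))"
      have k: "k \<in> wverts G - S" using False less.prems by blast
      have "x k = (\<Sum>l\<in>wverts G - {k}. ?c l * x l)"
        using eigen_equation_iff[OF assms(1,2) k] assms(3) k unfolding eigen_off_def by blast
      also have "\<dots> = (\<Sum>l\<in>wverts G - {k}. ?c l * (\<Sum>j\<in>S. exit_weight G S l j * x j))"
      proof (rule sum.cong)
        fix l assume l: "l \<in> wverts G - {k}"
        show "?c l * x l = ?c l * (\<Sum>j\<in>S. exit_weight G S l j * x j)"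
        \<comment> \<open>The measure drops along arcs only; for other \<open>l\<close> the
          coefficient is 0.\<close>
        proof (cases "(k, l) \<in> warcs G")
          case True
          then show ?thesis using less.hyps[of l] decreasing[of k l] l k by auto
        next
          case False
          then show ?thesis using assms(1) by (simp add: weighted_def)
        qed
      qed simp
      also have "\<dots> = (\<Sum>j\<in>S. (\<Sum>l\<in>wverts G - {k}. ?c l * exit_weight G S l j) * x j)"
        unfolding sum_distrib_left sum_distrib_right mult.assoc by (rule sum.swap)
      also have "\<dots> = (\<Sum>j\<in>S. exit_weight G S k j * x j)"
        by (intro sum.cong) (simp_all add: exit_weight_step[OF assms(1,2) k])
      finally show ?thesis .
    qed
  qed
qed

section \<open>Reductions satisfy the elimination property\<close>

lemma reduct_simps [simp]:
  "wverts (reduct S G) = S"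
  "warcs (reduct S G) = {(u, v). u \<in> S \<and> v \<in> S \<and> branches G S u v \<noteq> {}}"
  by (simp_all add: reduct_def)

text \<open>By \<open>wt_reduct\<close> the reduced matrix multiplies rows of \<open>G\<close> with
  exit weights; exchanging sums reassembles \<open>x\<close> by
  \<open>eigen_off_extension\<close>.\<close>

lemma reduces_reduct:
  assumes G: "weighted G" and S: "S \<in> st G"
  shows "reduces G (reduct S G)"
proof -
  have sub: "S \<subseteq> wverts G" using S by (simp add: st_def)
  have finS: "finite S" using G sub by (auto simp: weighted_def intro: finite_subset)
  have "warcs (reduct S G) = {(u, v). u \<in> S \<and> v \<in> S \<and> passes (warcs G) S u v}"
    using branches_nonempty_iff[OF G sub] by auto
  moreover have "wmult (reduct S G) x i = wmult G x i" if x: "eigen_off G S x" and i: "i \<in> S" for x i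
  proof -
    have "wmult (reduct S G) x i = (\<Sum>j\<in>S. (\<Sum>k\<in>wverts G. wt G (i, k) * exit_weight G S k j) * x j)"
      unfolding wmult_def reduct_simps using i by (intro sum.cong) (simp_all add: wt_reduct[OF G sub])
    also have "\<dots> = (\<Sum>k\<in>wverts G. wt G (i, k) * (\<Sum>j\<in>S. exit_weight G S k j * x j))"
      unfolding sum_distrib_left sum_distrib_right mult.assoc by (rule sum.swap)
    also have "\<dots> = wmult G x i"
      unfolding wmult_def by (intro sum.cong) (simp_all add: eigen_off_extension[OF G S x, symmetric])
    finally show ?thesis .
  qed
  moreover have "\<exists>x. (\<forall>i\<in>S. x i = y i) \<and> eigen_off G S x" for y
  proof -
    \<comment> \<open>By \<open>eigen_off_extension\<close> this is the only candidate on the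
      vertices of \<open>G\<close>.\<close>
    define x where "x k = (\<Sum>j\<in>S. exit_weight G S k j * y j)" for k
    have "x i = y i" if "i \<in> S" for i
    proof -
      have "x i = (\<Sum>j\<in>S. if i = j then y j else 0)"
        unfolding x_def using that sub by (intro sum.cong) (auto simp: exit_weight_from_S)
      then show ?thesis using that finS by simp
    qed
    moreover have "wmult G x k = ratX * x k" if k: "k \<in> wverts G - S" for k
    proof -
      let ?c = "\<lambda>l. wt G (k, l) / (ratX - wt G (k, k))"
      have "x k = (\<Sum>j\<in>S. (\<Sum>l\<in>wverts G - {k}. ?c l * exit_weight G S l j) * y j)"
        unfolding x_def by (intro sum.cong) (simp_all add: exit_weight_step[OF G S k])
      also have "\<dots> = (\<Sum>l\<in>wverts G - {k}. ?c l * x l)"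
        unfolding x_def sum_distrib_left sum_distrib_right mult.assoc by (rule sum.swap)
      finally show ?thesis using eigen_equation_iff[OF G S k] by blast
    qed
    ultimately show ?thesis by (auto simp: eigen_off_def)
  qed
  ultimately show ?thesis
    using weighted_reduct[OF G sub] sub unfolding reduces_def reduct_simps(1) by blast
qed

lemma reduces_reducts:
  "weighted G \<Longrightarrow> induces_reductions G Ss \<Longrightarrow> reduces G (reducts G Ss)"
proof (induction Ss arbitrary: G)
  case Nil
  then show ?case by (simp add: reduces_refl)
next
  case (Cons S Ss)
  then have "reduces G (reduct S G)" by (simp add: reduces_reduct)
  moreover from this have "weighted (reduct S G)" by (simp add: reduces_def)
  then have "reduces (reduct S G) (reducts (reduct S G) Ss)"
    using Cons by simp
  ultimately show ?case using reduces_trans by fastforce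
qed

lemma wverts_reducts_snoc: "wverts (reducts G (Ss @ [S])) = S"
  by (induction Ss arbitrary: G) auto

section \<open>Rational functions of nonpositive degree\<close>

text \<open>Fractions need not be in lowest terms, so sums and products require no cancelling. With
  \<open>degree 0 = 0\<close> zero is included.\<close>

definition proper_fracts :: "ratfun set" where
  "proper_fracts = {Fract p q | p q. q \<noteq> 0 \<and> degree p \<le> degree q}"

lemma ratdeg_nonpos_imp_proper:
  assumes "ratdeg w \<le> 0"
  shows "w \<in> proper_fracts"
proof -
  obtain p q where pq: "quot_of_fract w = (p, q)" by fastforce
  then have "w = Fract p q" "q \<noteq> 0"
    using Fract_quot_of_fract[of w] snd_quot_of_fract_nonzero[of w] by simp_all
  moreover have "degree p \<le> degree q"
    using assms pq by (auto simp: ratdeg_def zero_ereal_def split: if_splits)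
  ultimately show ?thesis unfolding proper_fracts_def by blast
qed

lemma proper_fracts_0 [simp]: "0 \<in> proper_fracts"
  unfolding proper_fracts_def using Zero_fract_def by force

lemma proper_fracts_1 [simp]: "1 \<in> proper_fracts"
  unfolding proper_fracts_def using One_fract_def by force

lemma proper_fracts_add:
  assumes "v \<in> proper_fracts" "w \<in> proper_fracts"
  shows "v + w \<in> proper_fracts"
proof -
  obtain p q r s where *: "v = Fract p q" "q \<noteq> 0" "degree p \<le> degree q"
    "w = Fract r s" "s \<noteq> 0" "degree r \<le> degree s"
    using assms unfolding proper_fracts_def by blast
  have "degree (p * s) \<le> degree (q * s)" "degree (r * q) \<le> degree (q * s)"
    using * degree_mult_le[of p s] degree_mult_le[of r q] by (simp_all add: degree_mult_eq)
  then have "degree (p * s + r * q) \<le> degree (q * s)" by (rule degree_add_le)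
  moreover have "v + w = Fract (p * s + r * q) (q * s)" "q * s \<noteq> 0" using * by simp_all
  ultimately show ?thesis unfolding proper_fracts_def by blast
qed

lemma proper_fracts_mult:
  assumes "v \<in> proper_fracts" "w \<in> proper_fracts"
  shows "v * w \<in> proper_fracts"
proof -
  obtain p q r s where *: "v = Fract p q" "q \<noteq> 0" "degree p \<le> degree q"
    "w = Fract r s" "s \<noteq> 0" "degree r \<le> degree s"
    using assms unfolding proper_fracts_def by blast
  have "degree (p * r) \<le> degree (q * s)"
    using * degree_mult_le[of p r] by (simp add: degree_mult_eq)
  moreover have "v * w = Fract (p * r) (q * s)" "q * s \<noteq> 0" using * by simp_all
  ultimately show ?thesis unfolding proper_fracts_def by blast
qed

lemma proper_fracts_sum: "(\<And>i. i \<in> A \<Longrightarrow> f i \<in> proper_fracts) \<Longrightarrow> sum f A \<in> proper_fracts"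
  by (induction A rule: infinite_finite_induct) (auto intro: proper_fracts_add)

lemma proper_fracts_prod: "(\<And>i. i \<in> A \<Longrightarrow> f i \<in> proper_fracts) \<Longrightarrow> prod f A \<in> proper_fracts"
  by (induction A rule: infinite_finite_induct) (auto intro: proper_fracts_mult)

section \<open>Differences \<open>\<lambda> - w\<close> for proper \<open>w\<close>\<close>

lemma degree_X_mult_diff:
  fixes p q :: "complex poly"
  assumes "q \<noteq> 0" "degree p \<le> degree q"
  shows "degree ([:0, 1:] * q - p) = Suc (degree q)"
proof -
  have "degree ([:0, 1:] * q) = Suc (degree q)" using assms(1) by (simp add: degree_mult_eq)
  then show ?thesis
    using degree_add_eq_left[of "- p" "[:0, 1:] * q"] assms(2) by simp
qed

lemma ratX_diff_Fract: "q \<noteq> 0 \<Longrightarrow> ratX - Fract p q = Fract ([:0, 1:] * q - p) q"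
  by (simp add: ratX_def to_fract_def)

text \<open>If \<open>\<lambda> = p / q\<close> with \<open>p\<close> of degree at most that of
  \<open>q\<close>, then \<open>\<lambda> q - p\<close> would vanish, although its degree exceeds
  that of \<open>q\<close>.\<close>

lemma ratX_not_proper: "ratX \<notin> proper_fracts"
proof
  assume "ratX \<in> proper_fracts"
  then obtain p q where *: "ratX = Fract p q" "q \<noteq> 0" "degree p \<le> degree q"
    unfolding proper_fracts_def by blast
  then have "Fract ([:0, 1:] * q - p) q = 0" using ratX_diff_Fract[of q p] by simp
  then have "[:0, 1:] * q - p = 0" using *(2) by (simp add: Zero_fract_def eq_fract)
  then show False using degree_X_mult_diff[OF *(2,3)] by simp
qed

text \<open>The inverse of \<open>\<lambda> - p / q\<close> has numerator \<open>q\<close>, of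
  degree one less than its denominator.\<close>

lemma proper_fracts_divide:
  assumes "v \<in> proper_fracts" "w \<in> proper_fracts"
  shows "v / (ratX - w) \<in> proper_fracts"
proof -
  obtain p q where *: "w = Fract p q" "q \<noteq> 0" "degree p \<le> degree q"
    using assms(2) unfolding proper_fracts_def by blast
  have deg: "degree ([:0, 1:] * q - p) = Suc (degree q)"
    using degree_X_mult_diff *(2,3) .
  then have "[:0, 1:] * q - p \<noteq> 0" by (metis degree_0 nat.distinct(1))
  moreover have "inverse (ratX - w) = Fract q ([:0, 1:] * q - p)"
    unfolding *(1) ratX_diff_Fract[OF *(2)] by (rule inverse_fract)
  ultimately have "inverse (ratX - w) \<in> proper_fracts"
    unfolding proper_fracts_def using deg by fastforce
  then show ?thesis using assms(1) by (simp add: divide_inverse proper_fracts_mult)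
qed

text \<open>Branch products use only ring operations and division by \<open>\<lambda> - w\<close>,
  so the degree bound survives every reduction.\<close>

lemma proper_reduct:
  assumes "\<And>e. wt G e \<in> proper_fracts"
  shows "wt (reduct S G) e \<in> proper_fracts"
proof -
  have "branch_prod G p \<in> proper_fracts" for p
    unfolding branch_prod_def
    by (intro proper_fracts_mult proper_fracts_prod proper_fracts_divide assms)
  then show ?thesis by (cases e) (simp add: reduct_def proper_fracts_sum)
qed

section \<open>Existence and uniqueness\<close>

text \<open>The graph induced on the empty set has no walk. This allows the trivial reduction that
  ends the deletion process.\<close>

lemma wverts_in_st: "wverts G \<noteq> {} \<Longrightarrow> wverts G \<in> st G"
  by (auto simp: st_def vcycle_def vwalk_def)

text \<open>On a single vertex the only possible arc is a loop, which \<open>del_loops\<close>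
  removes.\<close>

lemma st_delete_vertex:
  assumes "wverts G - {v} \<noteq> {}" "wt G (v, v) \<noteq> ratX"
  shows "wverts G - {v} \<in> st G"
proof -
  have "\<not> vcycle p (with_proj (del_loops (dgr G)) \<restriction> (wverts G - (wverts G - {v})))" for p
  proof
    assume "vcycle p (with_proj (del_loops (dgr G)) \<restriction> (wverts G - (wverts G - {v})))"
    moreover from this obtain a b q where "p = a # b # q"
      by (auto simp: vcycle_def numeral_2_eq_2 Suc_le_length_iff)
    ultimately show False
      by (auto simp: vcycle_def vwalk_def del_loops_def arcs_ends_conv)
  qed
  then show ?thesis using assms by (auto simp: st_def)
qed

text \<open>Vertices outside \<open>T\<close> are deleted one by one. The hypothesis is
  \<open>weighted\<close> instead of membership in \<open>wdigraphs\<close>, since a reduced graph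
  may have arcs of weight 0.\<close>

lemma reductions_exist:
  assumes "weighted G" "\<And>e. wt G e \<in> proper_fracts" "T \<noteq> {}" "T \<subseteq> wverts G"
  shows "\<exists>Ss. induces_reductions G (Ss @ [T])"
  using assms
proof (induction "card (wverts G - T)" arbitrary: G)
  case 0
  then have "T = wverts G" by (auto simp: weighted_def)
  \<comment> \<open>Even with nothing left to delete, the list must end with
    \<open>T\<close>.\<close>
  then have "induces_reductions G ([] @ [T])" using 0 wverts_in_st[of G] by simp
  then show ?case by blast
next
  case (Suc n)
  then obtain v where v: "v \<in> wverts G - T" by (metis card.empty ex_in_conv nat.distinct(1))
  let ?S = "wverts G - {v}"
  have "wt G (v, v) \<noteq> ratX" using Suc.prems(2) ratX_not_proper by metis
  then have S: "?S \<in> st G" using v Suc.prems(3,4) by (intro st_delete_vertex) auto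
  have "wverts (reduct ?S G) - T = (wverts G - T) - {v}" by auto
  then have "n = card (wverts (reduct ?S G) - T)"
    using Suc.hyps(2) v Suc.prems(1) by (simp add: weighted_def)
  moreover have "weighted (reduct ?S G)" using Suc.prems(1) by (intro weighted_reduct) auto
  ultimately obtain Ss where "induces_reductions (reduct ?S G) (Ss @ [T])"
    using Suc.hyps(1)[of "reduct ?S G"] Suc.prems v proper_reduct[of G ?S] by auto
  then have "induces_reductions G ((?S # Ss) @ [T])" using S by simp
  then show ?case by blast
qed

theorem theorem4:
  fixes G :: "'v wdigraph" and \<V> :: "'v set"
  assumes "G \<in> wdigraphs_pi"
    and "\<V> \<noteq> {}" and "\<V> \<subseteq> wverts G"
  shows "(\<exists>Ss. induces_reductions G (Ss @ [\<V>])) \<and>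
         (\<exists>H. \<forall>Ts. induces_reductions G (Ts @ [\<V>]) \<longrightarrow> reducts G (Ts @ [\<V>]) = H)"
proof -
  have fin: "pair_fin_digraph (dgr G)" and wt: "\<And>e. wt G e = 0 \<longleftrightarrow> e \<notin> warcs G"
    using assms(1) by (auto simp: wdigraphs_pi_def wdigraphs_def)
  interpret pair_fin_digraph "dgr G" by (rule fin)
  have arcs: "warcs G \<subseteq> wverts G \<times> wverts G" by (auto dest: in_arcsD1 in_arcsD2)
  have G: "weighted G"
    using wt arcs pair_finite_verts by (auto simp: weighted_def)
  \<comment> \<open>The degree bound is given on pairs of vertices only; off the arcs the weight is
    0.\<close>
  have "wt G e \<in> proper_fracts" for e
  proof (cases "e \<in> warcs G")
    case True
    then show ?thesis
      using arcs assms(1) by (auto simp: wdigraphs_pi_def intro!: ratdeg_nonpos_imp_proper)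
  next
    case False
    then show ?thesis using wt[of e] by simp
  qed
  then obtain Ss where Ss: "induces_reductions G (Ss @ [\<V>])"
    using reductions_exist[OF G] assms(2,3) by blast
  \<comment> \<open>Both sides reduce \<open>G\<close> to the vertex set \<open>\<V>\<close>, so
    \<open>reduces_unique\<close> applies; the sequence found above supplies the witness
    \<open>H\<close>.\<close>
  moreover have "reducts G (Ts @ [\<V>]) = reducts G (Ss @ [\<V>])"
    if "induces_reductions G (Ts @ [\<V>])" for Ts
    using that Ss G by (intro reduces_unique[of G] reduces_reducts) (simp_all only: wverts_reducts_snoc)
  ultimately show ?thesis by blast
qed

end
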